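(* Let $R$ be a ring having feckly adequate range $1$. Then $R$ is an elementary divisor ring if and only if $R$ is a Bézout ring.
   Context: All rings are commutative with identity. $J(R)$ denotes the Jacobson radical of $R$. A ring is a Bézout ring if every finitely generated ideal is principal. An element $c\in R$ is feckly adequate if for every $a\in R$ there exist $r,s\in R$ such that (i) $c\equiv rs \pmod{J(R)}$; (ii) $rR+aR=R$; (iii) $s'R+aR\neq R$ for each non-invertible divisor $s'$ of $s$ (i.e. each non-unit $s'\in R$ with $s\in s'R$). A ring $R$ has feckly adequate range $1$ if whenever $a,b\in R$ satisfy $aR+bR=R$, there exists $y\in R$ such that $a+by$ is feckly adequate. A matrix $A$ (not necessarily square) over $R$ admits diagonal reduction if there exist invertible matrices $P$ and $Q$ over $R$ such that $PAQ=(d_{ij})$ is a diagonal matrix with $d_{ii}$ a divisor of $d_{(i+1)(i+1)}$ for each $i$. A ring $R$ is an elementary divisor ring if every matrix over $R$ admits diagonal reduction. *)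

theory Defs
  imports Main "HOL-Library.Set_Algebras" "Jordan_Normal_Form.Matrix"
begin

text \<open>
  A commutative ring with identity is a type of sort \<open>{comm_ring, comm_monoid_mult}\<close>. This is
  \<open>comm_ring_1\<close> without the axiom \<open>0 \<noteq> 1\<close>, so the zero ring is not excluded. Properties of the
  whole ring take a \<open>TYPE('a)\<close> argument.
\<close>

subsection \<open>Ideals\<close>

definition is_ideal :: "'a::{comm_ring,comm_monoid_mult} set \<Rightarrow> bool" where
  "is_ideal I \<longleftrightarrow> 0 \<in> I \<and> (\<forall>x\<in>I. \<forall>y\<in>I. x + y \<in> I) \<and> (\<forall>r. \<forall>x\<in>I. r * x \<in> I)"

definition is_maximal_ideal :: "'a::{comm_ring,comm_monoid_mult} set \<Rightarrow> bool" where
  "is_maximal_ideal M \<longleftrightarrow> is_ideal M \<and> M \<noteq> UNIV \<and>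
     (\<forall>N. is_ideal N \<and> M \<subseteq> N \<longrightarrow> N = M \<or> N = UNIV)"

definition jacobson_radical :: "'a::{comm_ring,comm_monoid_mult} set" where
  "jacobson_radical = \<Inter> {M. is_maximal_ideal M}"

definition ideal_generated :: "'a::{comm_ring,comm_monoid_mult} set \<Rightarrow> 'a set" where
  "ideal_generated S = is_ideal hull S"

definition princ :: "'a::{comm_ring,comm_monoid_mult} \<Rightarrow> 'a set" where
  "princ a = range (\<lambda>x. a * x)"

definition bezout_ring :: "'a::{comm_ring,comm_monoid_mult} itself \<Rightarrow> bool" where
  "bezout_ring _ \<longleftrightarrow> (\<forall>S :: 'a set. finite S \<longrightarrow> (\<exists>d. ideal_generated S = princ d))"

subsection \<open>Feckly adequate range 1\<close>

text \<open>Below, \<open>+\<close> between sets is the elementwise sum from \<open>Set_Algebras\<close>, i.e. the sum of ideals.\<close>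

definition feckly_adequate :: "'a::{comm_ring,comm_monoid_mult} \<Rightarrow> bool" where
  "feckly_adequate c \<longleftrightarrow> (\<forall>a. \<exists>r s.
     c - r * s \<in> jacobson_radical \<and>
     princ r + princ a = UNIV \<and>
     (\<forall>s'. s' dvd s \<and> \<not> s' dvd 1 \<longrightarrow> princ s' + princ a \<noteq> UNIV))"

definition feckly_adequate_range_1 :: "'a::{comm_ring,comm_monoid_mult} itself \<Rightarrow> bool" where
  "feckly_adequate_range_1 _ \<longleftrightarrow>
     (\<forall>a b :: 'a. princ a + princ b = UNIV \<longrightarrow> (\<exists>y. feckly_adequate (a + b * y)))"

subsection \<open>Diagonal reduction\<close>

text \<open>
  This is \<^const>\<open>invertible_mat\<close>, restated because the latter is restricted to \<open>semiring_1\<close>,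
  which includes \<open>0 \<noteq> 1\<close>.
\<close>

definition inv_mat :: "'a::{comm_ring,comm_monoid_mult} mat \<Rightarrow> bool" where
  "inv_mat A \<longleftrightarrow> square_mat A \<and> (\<exists>B. A * B = 1\<^sub>m (dim_row A) \<and> B * A = 1\<^sub>m (dim_row B))"

definition admits_diagonal_reduction :: "'a::{comm_ring,comm_monoid_mult} mat \<Rightarrow> bool" where
  "admits_diagonal_reduction A \<longleftrightarrow> (\<exists>P Q.
     P \<in> carrier_mat (dim_row A) (dim_row A) \<and> inv_mat P \<and>
     Q \<in> carrier_mat (dim_col A) (dim_col A) \<and> inv_mat Q \<and>
     diagonal_mat (P * A * Q) \<and>
     (\<forall>i. i + 1 < dim_row A \<and> i + 1 < dim_col A \<longrightarrow>
        (P * A * Q) $$ (i, i) dvd (P * A * Q) $$ (i + 1, i + 1)))"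

definition elementary_divisor_ring :: "'a::{comm_ring,comm_monoid_mult} itself \<Rightarrow> bool" where
  "elementary_divisor_ring _ \<longleftrightarrow> (\<forall>A :: 'a mat. admits_diagonal_reduction A)"

end

theory Submission
  imports Defs
begin

text \<open>
  If \<open>c\<close> is feckly adequate in a Bezout ring and \<open>h\<close> divides \<open>c\<close>, then every unimodular triple
  \<open>(a, b, h)\<close> admits an \<open>r\<close> comaximal with \<open>a\<close> such that \<open>a + r b\<close> is comaximal with \<open>h\<close>. As a
  unimodular row can be moved by elementary operations to one with a feckly adequate entry, this
  shows that a Bezout ring with feckly adequate range 1 has stable range at most 2, hence is a
  Hermite ring (zero divisors are allowed), and that it satisfies Kaplansky's condition on
  triangular matrices of size 2, which makes a Hermite ring an elementary divisor ring.
\<close>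

section \<open>Comaximal elements\<close>

text \<open>The obstacle is zero divisors. If \<open>d = a * x + b * y\<close> is a gcd,
  \<open>a = d * a'\<close> and \<open>b = d * b'\<close>, then \<open>d\<close> cannot be
  cancelled, and \<open>a'\<close>, \<open>b'\<close> need not be comaximal; only
  \<open>d * (1 - a' * x - b' * y) = 0\<close> follows. The defect
  \<open>1 - a' * x - b' * y\<close> may be added to the cofactors without changing their products
  with \<open>d\<close>, and stable range chooses multiples of it that make the cofactors comaximal.

  Kaplansky's condition asks for more than stable range: the column chosen there is sent by the
  matrix to a vector with second entry \<open>r * h\<close>, so the first entry must be comaximal
  with \<open>r\<close> as well as with \<open>h\<close>. This is why \<open>r\<close> is taken from
  the decomposition of a feckly adequate element, which makes it comaximal with \<open>a\<close>.

  The clause on the divisors of \<open>s\<close> is usable because, in a Bezout ring, two elements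
  are comaximal as soon as their common divisors are units. The Jacobson radical enters through the
  units \<open>1 + j * y\<close>.\<close>

definition comaximal :: "'a::{comm_ring,comm_monoid_mult} \<Rightarrow> 'a \<Rightarrow> bool" where
  "comaximal a b \<longleftrightarrow> (\<exists>x y. a * x + b * y = 1)"

lemma comaximalI: "a * x + b * y = 1 \<Longrightarrow> comaximal a b"
  for a b :: "'a::{comm_ring,comm_monoid_mult}"
  unfolding comaximal_def by blast

lemma princ_eq: "princ a = {x. a dvd x}"
  for a :: "'a::{comm_ring,comm_monoid_mult}"
  by (auto simp: princ_def dvd_def)

lemma dvd_zero: "a dvd 0"
  for a :: "'a::{comm_ring,comm_monoid_mult}"
  by (metis dvd_triv_left mult_zero_right)

lemma zero_dvd: "0 dvd a \<Longrightarrow> a = 0"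
  for a :: "'a::{comm_ring,comm_monoid_mult}"
  by (elim dvdE) simp

lemma dvd_plus: "d dvd a \<Longrightarrow> d dvd b \<Longrightarrow> d dvd a + b"
  for a b d :: "'a::{comm_ring,comm_monoid_mult}"
  by (metis dvd_def distrib_left)

lemma dvd_linear: "c = x * a + y * b \<Longrightarrow> d dvd a \<Longrightarrow> d dvd b \<Longrightarrow> d dvd c"
  for a b c d :: "'a::{comm_ring,comm_monoid_mult}"
  by (simp add: dvd_plus dvd_mult)

lemma princ_plus_princ_eq_UNIV_iff: "princ a + princ b = UNIV \<longleftrightarrow> comaximal a b"
  for a b :: "'a::{comm_ring,comm_monoid_mult}"
proof
  assume "princ a + princ b = UNIV"
  then have "1 \<in> princ a + princ b" by simp
  then show "comaximal a b"
    unfolding comaximal_def princ_def by (auto elim!: set_plus_elim) metis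
next
  assume "comaximal a b"
  then obtain x y where xy: "a * x + b * y = 1" unfolding comaximal_def by blast
  have "z \<in> princ a + princ b" for z
  proof -
    have "z = (a * x + b * y) * z" by (simp add: xy)
    also have "\<dots> = a * (x * z) + b * (y * z)" by (simp add: algebra_simps)
    finally show ?thesis unfolding princ_def by (metis rangeI set_plus_intro)
  qed
  then show "princ a + princ b = UNIV" by blast
qed

lemma comaximal_dvd: "comaximal a b \<Longrightarrow> a' dvd a \<Longrightarrow> b' dvd b \<Longrightarrow> comaximal a' b'"
  for a b :: "'a::{comm_ring,comm_monoid_mult}"
  unfolding comaximal_def by (elim exE dvdE) (metis mult.assoc)

lemma comaximal_imp_unit: "comaximal a b \<Longrightarrow> d dvd a \<Longrightarrow> d dvd b \<Longrightarrow> d dvd 1"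
  for a b :: "'a::{comm_ring,comm_monoid_mult}"
  unfolding comaximal_def by (metis dvd_plus dvd_mult2)

lemma comaximal_mult_right:
  fixes a b c :: "'a::{comm_ring,comm_monoid_mult}"
  assumes "comaximal a b" "comaximal a c"
  shows "comaximal a (b * c)"
proof -
  obtain x y z w where 1: "a * x + b * y = 1" "a * z + c * w = 1"
    using assms unfolding comaximal_def by blast
  have "a * (x * (a * z + c * w) + b * y * z) + b * c * (y * w)
      = (a * x + b * y) * (a * z + c * w)"
    by (simp add: algebra_simps)
  then show ?thesis using 1 by (intro comaximalI) simp
qed

lemma comaximal_dvd_mult:
  fixes a b c :: "'a::{comm_ring,comm_monoid_mult}"
  assumes "comaximal a b" "a dvd b * c"
  shows "a dvd c"
proof -
  obtain x y where 1: "a * x + b * y = 1"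
    using assms unfolding comaximal_def by blast
  have "c = (a * x + b * y) * c" by (simp add: 1)
  also have "\<dots> = (x * c) * a + y * (b * c)" by (simp add: algebra_simps)
  finally show ?thesis by (rule dvd_linear) (simp_all add: assms(2))
qed

section \<open>Ideals and the Jacobson radical\<close>

lemma is_ideal_add: "is_ideal I \<Longrightarrow> x \<in> I \<Longrightarrow> y \<in> I \<Longrightarrow> x + y \<in> I"
  and is_ideal_mult: "is_ideal I \<Longrightarrow> x \<in> I \<Longrightarrow> r * x \<in> I"
  and is_ideal_zero: "is_ideal I \<Longrightarrow> 0 \<in> I"
  by (simp_all add: is_ideal_def)

lemma is_ideal_princ: "is_ideal (princ a)"
  for a :: "'a::{comm_ring,comm_monoid_mult}"
  unfolding is_ideal_def princ_eq by (auto simp: dvd_zero dvd_plus dvd_mult)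

lemma is_ideal_ideal_generated: "is_ideal (ideal_generated S)"
  for S :: "'a::{comm_ring,comm_monoid_mult} set"
  unfolding ideal_generated_def by (rule hull_in) (auto simp: is_ideal_def)

lemma ideal_generated_superset: "S \<subseteq> ideal_generated S"
  for S :: "'a::{comm_ring,comm_monoid_mult} set"
  unfolding ideal_generated_def by (rule hull_subset)

lemma ideal_generated_minimal: "S \<subseteq> I \<Longrightarrow> is_ideal I \<Longrightarrow> ideal_generated S \<subseteq> I"
  for S :: "'a::{comm_ring,comm_monoid_mult} set"
  unfolding ideal_generated_def by (rule hull_minimal)

lemma is_ideal_sum:
  assumes "is_ideal I" "\<And>x. x \<in> S \<Longrightarrow> f x \<in> I"
  shows "sum f S \<in> I"
  using assms(2) by (induction S rule: infinite_finite_induct)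
    (simp_all add: assms(1) is_ideal_zero is_ideal_add)

text \<open>A non-unit \<open>1 + j * y\<close> lies in a maximal ideal, obtained from Zorn's lemma
  among the ideals avoiding \<open>1\<close>; this ideal also contains \<open>j\<close>, hence
  \<open>1\<close>.\<close>

lemma jacobson_radical_unit:
  fixes j :: "'a::{comm_ring,comm_monoid_mult}"
  assumes j: "j \<in> jacobson_radical"
  shows "1 + j * y dvd 1"
proof (rule ccontr)
  assume "\<not> ?thesis"
  then have nu: "1 \<notin> princ (1 + j * y)" by (simp add: princ_eq)
  define F where "F = {N :: 'a set. is_ideal N \<and> 1 + j * y \<in> N \<and> 1 \<notin> N}"
  have "princ (1 + j * y) \<in> F"
    using nu by (auto simp: F_def is_ideal_princ) (simp add: princ_eq)
  moreover have "\<Union>C \<in> F" if "C \<noteq> {}" "subset.chain F C" for C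
  proof -
    have CF: "C \<subseteq> F" and lin: "\<And>X Y. X \<in> C \<Longrightarrow> Y \<in> C \<Longrightarrow> X \<subseteq> Y \<or> Y \<subseteq> X"
      using that(2) by (auto simp: subset.chain_def)
    have "x + x' \<in> \<Union>C" if "x \<in> \<Union>C" "x' \<in> \<Union>C" for x x'
    proof -
      obtain X Y where X: "X \<in> C" "x \<in> X" "Y \<in> C" "x' \<in> Y" using \<open>x \<in> \<Union>C\<close> \<open>x' \<in> \<Union>C\<close> by blast
      then obtain Z where "Z \<in> C" "x \<in> Z" "x' \<in> Z" using lin by blast
      then show ?thesis using CF is_ideal_add unfolding F_def by blast
    qed
    moreover have "r * x \<in> \<Union>C" if "x \<in> \<Union>C" for r x
      using that CF is_ideal_mult unfolding F_def by blast
    moreover have "0 \<in> \<Union>C" "1 + j * y \<in> \<Union>C" "1 \<notin> \<Union>C"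
      using that(1) CF is_ideal_zero unfolding F_def by blast+
    ultimately show ?thesis unfolding F_def is_ideal_def by simp
  qed
  ultimately obtain M where M: "M \<in> F" and max: "\<And>X. X \<in> F \<Longrightarrow> M \<subseteq> X \<Longrightarrow> X = M"
    using subset_Zorn_nonempty[of F] by blast
  have iM: "is_ideal M" "1 + j * y \<in> M" "1 \<notin> M" using M by (auto simp: F_def)
  have "N = M \<or> N = UNIV" if "is_ideal N" "M \<subseteq> N" for N
  proof (cases "1 \<in> N")
    case True
    then have "x * 1 \<in> N" for x by (intro is_ideal_mult that(1))
    then show ?thesis by auto
  next
    case False
    then show ?thesis using that max[of N] iM by (auto simp: F_def)
  qed
  then have "is_maximal_ideal M" using iM by (auto simp: is_maximal_ideal_def)
  then have "j \<in> M" using j unfolding jacobson_radical_def by blast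
  then have "(1 + j * y) + (- y) * j \<in> M" by (intro is_ideal_add is_ideal_mult iM)
  also have "(1 + j * y) + (- y) * j = 1" by (simp add: mult.commute)
  finally show False using iM(3) by contradiction
qed

lemma bezout_ring_gcd:
  fixes a b :: "'a::{comm_ring,comm_monoid_mult}"
  assumes "bezout_ring TYPE('a)"
  obtains d x y where "d dvd a" "d dvd b" "d = a * x + b * y"
proof -
  have "finite {a, b}" by simp
  then obtain d where d: "ideal_generated {a, b} = princ d"
    using assms unfolding bezout_ring_def by blast
  let ?I = "{u. \<exists>x y. u = a * x + b * y}"
  have "is_ideal ?I"
    unfolding is_ideal_def
  proof (intro conjI ballI allI)
    show "0 \<in> ?I" by (rule CollectI, rule exI[of _ 0], rule exI[of _ 0]) simp
  next
    fix u v assume "u \<in> ?I" "v \<in> ?I"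
    then obtain x y x' y' where "u = a * x + b * y" "v = a * x' + b * y'" by blast
    then have "u + v = a * (x + x') + b * (y + y')" by (simp add: algebra_simps)
    then show "u + v \<in> ?I" by blast
  next
    fix r u assume "u \<in> ?I"
    then obtain x y where "u = a * x + b * y" by blast
    then have "r * u = a * (r * x) + b * (r * y)" by (simp add: algebra_simps)
    then show "r * u \<in> ?I" by blast
  qed
  moreover have "a \<in> ?I" by (rule CollectI, rule exI[of _ 1], rule exI[of _ 0]) simp
  moreover have "b \<in> ?I" by (rule CollectI, rule exI[of _ 0], rule exI[of _ 1]) simp
  ultimately have "princ d \<subseteq> ?I" unfolding d[symmetric] by (intro ideal_generated_minimal) simp_all
  moreover have "d \<in> princ d" by (simp add: princ_eq)
  ultimately obtain x y where xy: "d = a * x + b * y" by blast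
  have "{a, b} \<subseteq> princ d" unfolding d[symmetric] by (rule ideal_generated_superset)
  then have "d dvd a" "d dvd b" by (simp_all add: princ_eq)
  from this xy show thesis by (rule that)
qed

text \<open>A gcd is a linear combination, so a unit gcd can be scaled to a Bezout identity.\<close>

lemma bezout_ring_comaximalI:
  fixes a b :: "'a::{comm_ring,comm_monoid_mult}"
  assumes "bezout_ring TYPE('a)" and "\<And>d. d dvd a \<Longrightarrow> d dvd b \<Longrightarrow> d dvd 1"
  shows "comaximal a b"
proof -
  obtain d x y where d: "d dvd a" "d dvd b" "d = a * x + b * y"
    using bezout_ring_gcd[OF assms(1)] .
  have "d dvd 1" using d(1,2) by (rule assms(2))
  then obtain e where e: "1 = d * e" by (elim dvdE)
  have "a * (x * e) + b * (y * e) = d * e" by (simp add: d(3) algebra_simps)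
  then show ?thesis unfolding e[symmetric] by (rule comaximalI)
qed

section \<open>Feckly adequate elements\<close>

text \<open>The witness is the factor \<open>r\<close> in the decomposition of \<open>c\<close> relative to \<open>a\<close>; it works for every
  \<open>h\<close> dividing \<open>c\<close>.\<close>

lemma feckly_adequate_stable:
  fixes a b c h :: "'a::{comm_ring,comm_monoid_mult}"
  assumes bez: "bezout_ring TYPE('a)" and fa: "feckly_adequate c" and hc: "h dvd c"
    and one: "\<And>d. d dvd a \<Longrightarrow> d dvd b \<Longrightarrow> d dvd h \<Longrightarrow> d dvd 1"
  obtains r where "comaximal r a" "comaximal (a + r * b) h"
proof -
  obtain r s where j: "c - r * s \<in> jacobson_radical" and ra: "comaximal r a"
    and sa: "\<And>s'. s' dvd s \<Longrightarrow> comaximal s' a \<Longrightarrow> s' dvd 1"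
    using fa[unfolded feckly_adequate_def princ_plus_princ_eq_UNIV_iff, rule_format, of a] by blast
  have "g dvd 1" if g: "g dvd a + r * b" "g dvd h" for g
  proof -
    have a_if: "k dvd a" if "k dvd r" "k dvd a + r * b" for k
    proof -
      have "a = 1 * (a + r * b) + (- b) * r" by (simp add: algebra_simps)
      then show ?thesis using that(2,1) by (rule dvd_linear)
    qed
    have gr: "comaximal g r"
    proof (rule bezout_ring_comaximalI[OF bez])
      fix k assume "k dvd g" "k dvd r"
      then have "k dvd a" using a_if g(1) dvd_trans by blast
      then show "k dvd 1" using ra \<open>k dvd r\<close> comaximal_imp_unit by blast
    qed
    \<comment> \<open>A common divisor of \<open>g\<close> and \<open>s\<close> turns out to be
      comaximal with \<open>a\<close>, which the choice of \<open>s\<close> allows only for units.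
      For a divisor \<open>k\<close> of \<open>f\<close> and \<open>a\<close>, comaximality of
      \<open>g\<close> and \<open>r\<close> lets \<open>r\<close> be removed from
      \<open>k dvd r * b\<close>.\<close>
    have "comaximal g s"
    proof (rule bezout_ring_comaximalI[OF bez])
      fix f assume f: "f dvd g" "f dvd s"
      have "comaximal f a"
      proof (rule bezout_ring_comaximalI[OF bez])
        fix k assume k: "k dvd f" "k dvd a"
        then have kg: "k dvd g" using f dvd_trans by blast
        have "r * b = 1 * (a + r * b) + (- 1) * a" by (simp add: algebra_simps)
        then have "k dvd r * b" using dvd_trans[OF kg g(1)] k(2) by (rule dvd_linear)
        then have "k dvd b" using comaximal_dvd[OF gr kg dvd_refl] comaximal_dvd_mult by blast
        then show "k dvd 1" using one k(2) kg g(2) dvd_trans by blast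
      qed
      then show "f dvd 1" using sa f(2) by blast
    qed
    with gr have "comaximal g (r * s)" by (rule comaximal_mult_right)
    then obtain x y where xy: "g * x + r * s * y = 1" unfolding comaximal_def by blast
    obtain e where e: "c = g * e" using dvd_trans[OF g(2) hc] by (elim dvdE)
    \<comment> \<open>Since \<open>g\<close> divides \<open>c\<close>, replacing
      \<open>r * s\<close> by \<open>c\<close> in the Bezout identity makes \<open>g\<close> a
      divisor of \<open>1 + j * y\<close> with \<open>j = c - r * s\<close>, which is a
      unit.\<close>
    have "g * (x + e * y) = (g * x + r * s * y) + (c - r * s) * y"
      by (simp add: e algebra_simps)
    then have "g dvd 1 + (c - r * s) * y" unfolding xy by (rule dvdI[OF sym])
    then show "g dvd 1" using jacobson_radical_unit[OF j] dvd_trans by blast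
  qed
  then have "comaximal (a + r * b) h" by (intro bezout_ring_comaximalI[OF bez])
  with ra show thesis by (rule that)
qed

lemma feckly_adequate_range_1_hermite:
  fixes a b :: "'a::{comm_ring,comm_monoid_mult}"
  assumes bez: "bezout_ring TYPE('a)" and fa: "feckly_adequate_range_1 TYPE('a)"
  obtains d a' b' where "a = d * a'" "b = d * b'" "comaximal a' b'"
proof -
  obtain d x y where dvd: "d dvd a" "d dvd b" and d: "d = a * x + b * y"
    using bezout_ring_gcd[OF bez] .
  obtain a' b' where a': "a = d * a'" and b': "b = d * b'" using dvd by (elim dvdE)
  define c where "c = 1 - a' * x - b' * y"
  have "d * c = d - (d * a' * x + d * b' * y)" by (simp add: c_def algebra_simps)
  then have dc: "d * c = 0" using d unfolding a'[symmetric] b'[symmetric] by simp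
  have "a' * x + (b' * y + c) * 1 = 1" by (simp add: c_def algebra_simps)
  then have "comaximal a' (b' * y + c)" by (rule comaximalI)
  \<comment> \<open>The triple \<open>(a', b', c)\<close> is unimodular; grouping its last two
    entries as \<open>b' * y + c\<close> gives a comaximal pair for the range condition.\<close>
  then obtain t where t: "feckly_adequate (a' + (b' * y + c) * t)" (is "feckly_adequate ?w")
    using fa unfolding feckly_adequate_range_1_def princ_plus_princ_eq_UNIV_iff by blast
  have "e dvd 1" if e: "e dvd b'" "e dvd c" "e dvd ?w" for e
  proof -
    have "a' = 1 * ?w + (- t) * (y * b' + 1 * c)" by (simp add: algebra_simps)
    then have "e dvd a'" using e(3) by (rule dvd_linear) (rule dvd_linear[OF refl e(1,2)])
    then have "e dvd a' * x + b' * y + c" using e by (intro dvd_plus[OF dvd_plus] dvd_mult2)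
    then show ?thesis by (simp add: c_def algebra_simps)
  qed
  from feckly_adequate_stable[OF bez t dvd_refl this]
  obtain v where v: "comaximal (b' + v * c) ?w" by blast
  \<comment> \<open>Both differ from \<open>b'\<close> and \<open>a'\<close> by multiples of
    \<open>c\<close>, which \<open>d\<close> annihilates. The coefficient in \<open>?a\<close> is
    the one for which \<open>?w\<close> is \<open>?a\<close> plus a multiple of
    \<open>?b\<close>.\<close>
  let ?b = "b' + v * c" and ?a = "a' + c * (t - v * y * t)"
  have w: "?w = ?a + ?b * (y * t)" by (simp add: algebra_simps)
  have "comaximal ?a ?b"
  proof (rule bezout_ring_comaximalI[OF bez])
    fix e assume e: "e dvd ?a" "e dvd ?b"
    then have "e dvd ?w" unfolding w by (rule dvd_plus[OF _ dvd_mult2])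
    then show "e dvd 1" using v e comaximal_imp_unit by blast
  qed
  moreover have "d * ?a = d * a' + d * c * (t - v * y * t)" "d * ?b = d * b' + v * (d * c)"
    by (simp_all add: algebra_simps)
  then have "a = d * ?a" "b = d * ?b" using a' b' by (simp_all add: dc)
  ultimately show thesis using that by blast
qed

text \<open>Kaplansky's condition. In the matrix with rows \<open>(a, 0)\<close> and \<open>(b, c)\<close>, elementary operations
  make \<open>b\<close> feckly adequate. A column operation then replaces the second row by \<open>(h, 0)\<close> with
  \<open>h = gcd b c\<close>, a divisor of a feckly adequate element.\<close>

lemma feckly_adequate_range_1_kaplansky:
  fixes a b c :: "'a::{comm_ring,comm_monoid_mult}"
  assumes bez: "bezout_ring TYPE('a)" and fa: "feckly_adequate_range_1 TYPE('a)"
    and one: "a * x + b * y + c * z = 1"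
  obtains p q m n where "p * (a * m) + q * (b * m + c * n) = 1"
proof -
  have "b * y + (a * x + c * z) * 1 = 1" using one by (simp add: algebra_simps)
  then have "comaximal b (a * x + c * z)" by (rule comaximalI)
  \<comment> \<open>This entry arises by adding \<open>x * t\<close> times the first row to the
    second and \<open>z * t\<close> times the second column to the first; the matrix stays
    triangular.\<close>
  then obtain t where t: "feckly_adequate (b + (a * x + c * z) * t)" (is "feckly_adequate ?b")
    using fa unfolding feckly_adequate_range_1_def princ_plus_princ_eq_UNIV_iff by blast
  obtain h b1 c1 where h: "?b = h * b1" "c = h * c1" "comaximal b1 c1"
    using feckly_adequate_range_1_hermite[OF bez fa] .
  then obtain u v where uv: "b1 * u + c1 * v = 1" unfolding comaximal_def by blast
  \<comment> \<open>The columns \<open>(u, v)\<close> and \<open>(c1, - b1)\<close> are mapped to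
    \<open>(a * u, h)\<close> and \<open>(a * c1, 0)\<close>.\<close>
  have "e dvd 1" if e: "e dvd a * c1" "e dvd a * u" "e dvd h" for e
  proof -
    have "a = a * (b1 * u + c1 * v)" by (simp add: uv)
    also have "\<dots> = b1 * (a * u) + v * (a * c1)" by (simp add: algebra_simps)
    finally have ea: "e dvd a" using e(2,1) by (rule dvd_linear)
    have eb: "e dvd ?b" "e dvd c"
      using dvd_mult2[OF e(3), of b1] dvd_mult2[OF e(3), of c1] by (simp_all only: h(1) h(2)[symmetric])
    have "1 = a * (x - x * t * y) + ?b * y + c * (z - z * t * y)"
      using one by (simp add: algebra_simps)
    also have "e dvd \<dots>" using ea eb by (intro dvd_plus[OF dvd_plus] dvd_mult2)
    finally show ?thesis .
  qed
  then obtain r where r: "comaximal r (a * c1)" "comaximal (a * c1 + r * (a * u)) h"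
    using feckly_adequate_stable[OF bez t] by (metis h(1) dvd_triv_left)
  \<comment> \<open>The column \<open>(m, n)\<close> is \<open>r * (u, v) + (c1, - b1)\<close>, so
    its image is \<open>(a * c1 + r * (a * u), r * h)\<close>.\<close>
  define m where "m = u * r + c1"
  define n where "n = v * r - b1"
  have am: "a * m = a * c1 + r * (a * u)" by (simp add: m_def algebra_simps)
  have "h * b1 * m + h * c1 * n = r * h * (b1 * u + c1 * v)"
    by (simp add: m_def n_def algebra_simps)
  then have bm: "?b * m + c * n = r * h" using uv h by simp
  have "comaximal (a * m) r"
  proof (rule bezout_ring_comaximalI[OF bez])
    fix e assume e: "e dvd a * m" "e dvd r"
    have "a * c1 = 1 * (a * m) + (- (a * u)) * r" by (simp add: am algebra_simps)
    then have "e dvd a * c1" using e by (rule dvd_linear)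
    then show "e dvd 1" using r(1) e(2) comaximal_imp_unit by blast
  qed
  moreover have "comaximal (a * m) h" using r(2) by (simp add: am)
  ultimately have "comaximal (a * m) (?b * m + c * n)"
    unfolding bm by (rule comaximal_mult_right)
  then obtain p q where "a * m * p + (?b * m + c * n) * q = 1" unfolding comaximal_def by blast
  \<comment> \<open>Undoing the initial row and column operations alters only \<open>p\<close> and
    \<open>n\<close>.\<close>
  then have "(p + q * x * t) * (a * m) + q * (b * m + c * (n + z * t * m)) = 1"
    by (simp add: algebra_simps)
  then show thesis by (rule that)
qed

section \<open>Equivalence of arrays\<close>

text \<open>Arrays are functions of two indices, and the equivalence below only operates on rows in \<open>I\<close>
  and columns in \<open>K\<close>. An equivalence of a block of an array is then an equivalence of the
  whole array, which avoids block matrices.\<close>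

definition row_op :: "nat \<Rightarrow> nat \<Rightarrow> 'a \<Rightarrow> 'a \<Rightarrow> 'a \<Rightarrow> 'a \<Rightarrow>
  (nat \<Rightarrow> nat \<Rightarrow> 'a) \<Rightarrow> nat \<Rightarrow> nat \<Rightarrow> 'a::{comm_ring,comm_monoid_mult}" where
  "row_op i j p q u v A r c =
     (if r = i then p * A i c + q * A j c else if r = j then u * A i c + v * A j c else A r c)"

definition col_op :: "nat \<Rightarrow> nat \<Rightarrow> 'a \<Rightarrow> 'a \<Rightarrow> 'a \<Rightarrow> 'a \<Rightarrow>
  (nat \<Rightarrow> nat \<Rightarrow> 'a) \<Rightarrow> nat \<Rightarrow> nat \<Rightarrow> 'a::{comm_ring,comm_monoid_mult}" where
  "col_op i j p q u v A r c =
     (if c = i then p * A r i + q * A r j else if c = j then u * A r i + v * A r j else A r c)"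

abbreviation (input) flip :: "(nat \<Rightarrow> nat \<Rightarrow> 'a) \<Rightarrow> nat \<Rightarrow> nat \<Rightarrow> 'a" where
  "flip A \<equiv> \<lambda>r c. A c r"

lemma flip_row_op: "flip (row_op i j p q u v A) = col_op i j p q u v (flip A)"
  by (auto simp: row_op_def col_op_def fun_eq_iff)

lemma flip_col_op: "flip (col_op i j p q u v A) = row_op i j p q u v (flip A)"
  by (auto simp: row_op_def col_op_def fun_eq_iff)

lemma row_op_inverse:
  assumes "i \<noteq> j" "p * v - q * u = 1"
  shows "row_op i j v (- q) (- u) p (row_op i j p q u v A) = A"
proof -
  have "v * (p * x + q * y) + - q * (u * x + v * y) = (p * v - q * u) * x"
    "- u * (p * x + q * y) + p * (u * x + v * y) = (p * v - q * u) * y" for x y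
    by (simp_all add: algebra_simps)
  then show ?thesis using assms by (auto simp: row_op_def fun_eq_iff)
qed

lemma col_op_inverse:
  assumes "i \<noteq> j" "p * v - q * u = 1"
  shows "col_op i j v (- q) (- u) p (col_op i j p q u v A) = A"
proof -
  have "flip (col_op i j v (- q) (- u) p (col_op i j p q u v A)) = flip A"
    using row_op_inverse[OF assms, of "flip A"] by (simp only: flip_col_op)
  then show ?thesis unfolding fun_eq_iff by simp
qed

inductive array_equiv :: "nat set \<Rightarrow> nat set \<Rightarrow>
  (nat \<Rightarrow> nat \<Rightarrow> 'a) \<Rightarrow> (nat \<Rightarrow> nat \<Rightarrow> 'a::{comm_ring,comm_monoid_mult}) \<Rightarrow> bool"
  for I K A where
  refl: "array_equiv I K A A"
| row: "array_equiv I K A B \<Longrightarrow> i \<in> I \<Longrightarrow> j \<in> I \<Longrightarrow> i \<noteq> j \<Longrightarrow> p * v - q * u = 1 \<Longrightarrow>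
    array_equiv I K A (row_op i j p q u v B)"
| col: "array_equiv I K A B \<Longrightarrow> i \<in> K \<Longrightarrow> j \<in> K \<Longrightarrow> i \<noteq> j \<Longrightarrow> p * v - q * u = 1 \<Longrightarrow>
    array_equiv I K A (col_op i j p q u v B)"

lemma array_equiv_trans:
  assumes "array_equiv I K A B" "array_equiv I K B C"
  shows "array_equiv I K A C"
  using assms(2,1) by induction (blast intro: array_equiv.row array_equiv.col)+

lemma array_equiv_sym:
  assumes "array_equiv I K A B"
  shows "array_equiv I K B A"
  using assms
proof induction
  case refl
  show ?case by (rule array_equiv.refl)
next
  case (row B i j p v q u)
  have "v * p - - q * - u = 1" using row(5) by (simp add: mult.commute)
  from array_equiv.row[OF array_equiv.refl[of _ K "row_op i j p q u v B"] row(2,3,4) this]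
    row_op_inverse[OF row(4,5), of B]
  have "array_equiv I K (row_op i j p q u v B) B" by simp
  then show ?case using row.IH by (rule array_equiv_trans)
next
  case (col B i j p v q u)
  have "v * p - - q * - u = 1" using col(5) by (simp add: mult.commute)
  from array_equiv.col[OF array_equiv.refl[of I _ "col_op i j p q u v B"] col(2,3,4) this]
    col_op_inverse[OF col(4,5), of B]
  have "array_equiv I K (col_op i j p q u v B) B" by simp
  then show ?case using col.IH by (rule array_equiv_trans)
qed

lemma array_equiv_mono:
  assumes "array_equiv I K A B" "I \<subseteq> I'" "K \<subseteq> K'"
  shows "array_equiv I' K' A B"
  using assms by induction (blast intro: array_equiv.intros)+

lemma array_equiv_flip:
  assumes "array_equiv I K A B"
  shows "array_equiv K I (flip A) (flip B)"
  using assms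
proof induction
  case refl
  show ?case by (rule array_equiv.refl)
next
  case (row B i j p v q u)
  then show ?case unfolding flip_row_op by (intro array_equiv.col) auto
next
  case (col B i j p v q u)
  then show ?case unfolding flip_col_op by (intro array_equiv.row) auto
qed

lemma array_equiv_dvd:
  assumes "array_equiv I K A B" "I \<subseteq> R \<or> I \<inter> R = {}" "K \<subseteq> S \<or> K \<inter> S = {}"
    and "\<And>r c. r \<in> R \<Longrightarrow> c \<in> S \<Longrightarrow> d dvd A r c"
  shows "r \<in> R \<Longrightarrow> c \<in> S \<Longrightarrow> d dvd B r c"
  using assms(1)
proof (induction arbitrary: r c)
  case refl
  then show ?case by (rule assms(4))
next
  case (row B i j p v q u)
  have "d dvd B i c" "d dvd B j c" if "r = i \<or> r = j"
    using that row assms(2) by blast+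
  then show ?case using row by (auto simp: row_op_def intro!: dvd_plus dvd_mult)
next
  case (col B i j p v q u)
  have "d dvd B r i" "d dvd B r j" if "c = i \<or> c = j"
    using that col assms(3) by blast+
  then show ?case using col by (auto simp: col_op_def intro!: dvd_plus dvd_mult)
qed

lemma array_equiv_outside:
  assumes "array_equiv I K A B" "r \<notin> I" "c \<notin> K"
  shows "B r c = A r c"
  using assms by induction (auto simp: row_op_def col_op_def)

section \<open>Pivots\<close>

definition has_pivot :: "nat set \<Rightarrow> nat set \<Rightarrow> (nat \<Rightarrow> nat \<Rightarrow> 'a::{comm_ring,comm_monoid_mult}) \<Rightarrow> bool" where
  "has_pivot I K A \<longleftrightarrow> (\<exists>B i k. array_equiv I K A B \<and> i \<in> I \<and> k \<in> K \<and>
     (\<forall>r\<in>I. \<forall>c\<in>K. B i k dvd B r c))"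

text \<open>Common divisors of the block are invariant under equivalence, so the pivot need only be
  compared with the original entries.\<close>

lemma has_pivotI:
  assumes "array_equiv I K A B" "i \<in> I" "k \<in> K" "\<And>r c. r \<in> I \<Longrightarrow> c \<in> K \<Longrightarrow> B i k dvd A r c"
  shows "has_pivot I K A"
  unfolding has_pivot_def using assms array_equiv_dvd[OF assms(1), of I K "B i k"] by blast

lemma has_pivot_flip:
  assumes "has_pivot I K (flip A)"
  shows "has_pivot K I A"
proof -
  obtain B i k where B: "array_equiv I K (flip A) B" "i \<in> I" "k \<in> K"
    "\<forall>r\<in>I. \<forall>c\<in>K. B i k dvd B r c"
    using assms unfolding has_pivot_def by blast
  have "array_equiv K I A (flip B)" using array_equiv_flip[OF B(1)] .
  then show ?thesis
    unfolding has_pivot_def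
    by (intro exI[of _ "flip B"] exI[of _ k] exI[of _ i]) (use B(2-) in auto)
qed

text \<open>If the pivot of the rows in \<open>I\<close> lies in row \<open>i\<close>, a pivot of the two rows \<open>i0\<close> and \<open>i\<close>
  divides it, and so is a pivot for everything.\<close>

lemma has_pivot_insert:
  fixes A :: "nat \<Rightarrow> nat \<Rightarrow> 'a::{comm_ring,comm_monoid_mult}"
  assumes "has_pivot I K A" "i0 \<notin> I"
    and two: "\<And>i (A :: nat \<Rightarrow> nat \<Rightarrow> 'a). i \<in> I \<Longrightarrow> has_pivot {i0, i} K A"
  shows "has_pivot (insert i0 I) K A"
proof -
  obtain B i k where B: "array_equiv I K A B" "i \<in> I" "k \<in> K"
    "\<And>r c. r \<in> I \<Longrightarrow> c \<in> K \<Longrightarrow> B i k dvd B r c"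
    using assms(1) unfolding has_pivot_def by blast
  obtain C j l where C: "array_equiv {i0, i} K B C" "j \<in> {i0, i}" "l \<in> K"
    "\<And>r c. r \<in> {i0, i} \<Longrightarrow> c \<in> K \<Longrightarrow> C j l dvd C r c"
    using two[OF B(2), of B] unfolding has_pivot_def by blast
  have "C j l dvd B r c" if "r \<in> {i0, i}" "c \<in> K" for r c
    using array_equiv_dvd[OF array_equiv_sym[OF C(1)], of "{i0, i}" K "C j l"] C(4) that by blast
  then have CB: "C j l dvd B r c" if "r \<in> insert i0 I" "c \<in> K" for r c
    using that B(2,3,4) dvd_trans by blast
  have "array_equiv (insert i0 I) K A B" using B(1) by (rule array_equiv_mono) auto
  moreover have BC: "array_equiv (insert i0 I) K B C" using C(1) by (rule array_equiv_mono) (use B(2) in auto)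
  ultimately have "array_equiv (insert i0 I) K A C" by (rule array_equiv_trans)
  moreover have "C j l dvd C r c" if "r \<in> insert i0 I" "c \<in> K" for r c
    using array_equiv_dvd[OF BC subset_refl[THEN disjI1] subset_refl[THEN disjI1] CB] that by blast
  ultimately show ?thesis using B(2) C(2,3) unfolding has_pivot_def by blast
qed

lemma has_pivot_induct:
  fixes A :: "nat \<Rightarrow> nat \<Rightarrow> 'a::{comm_ring,comm_monoid_mult}"
  assumes "finite I" "I \<noteq> {}"
    and one: "\<And>i (A :: nat \<Rightarrow> nat \<Rightarrow> 'a). has_pivot {i} K A"
    and two: "\<And>i j (A :: nat \<Rightarrow> nat \<Rightarrow> 'a). i \<noteq> j \<Longrightarrow> has_pivot {i, j} K A"
  shows "has_pivot I K A"
  using assms(1,2)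
proof (induction arbitrary: A rule: finite_ne_induct)
  case (singleton i)
  show ?case by (rule one)
next
  case (insert i I)
  show ?case
    by (rule has_pivot_insert[OF insert.IH insert.hyps(3)], rule two) (use insert.hyps(3) in auto)
qed

text \<open>In \<open>kaplansky\<close>, the matrix with rows \<open>(a, 0)\<close> and
  \<open>(b, c)\<close>, multiplied by the row \<open>(p, q)\<close> on the left and the column
  \<open>(m, n)\<close> on the right, gives \<open>1\<close>.\<close>

locale hermite_kaplansky =
  fixes ring :: "'a::{comm_ring,comm_monoid_mult} itself"
  assumes hermite: "\<exists>d a' b'. (a::'a) = d * a' \<and> b = d * b' \<and> comaximal a' b'"
    and kaplansky: "(a::'a) * x + b * y + c * z = 1 \<Longrightarrow>
      \<exists>p q m n. p * (a * m) + q * (b * m + c * n) = 1"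
begin

text \<open>Dividing by a gcd need not leave a unimodular triple, so \<open>hermite\<close> is
  applied twice, the second time to the gcd of the first pair and \<open>c\<close>.\<close>

lemma triangular_gcd:
  fixes a b c :: 'a
  obtains d a' b' c' x y z where "a = d * a'" "b = d * b'" "c = d * c'" "a' * x + b' * y + c' * z = 1"
proof -
  obtain e a1 b1 x1 y1 where ab: "a = e * a1" "b = e * b1" "a1 * x1 + b1 * y1 = 1"
    using hermite[of a b] unfolding comaximal_def by blast
  obtain d e' c' x2 z where ec: "e = d * e'" "c = d * c'" "e' * x2 + c' * z = 1"
    using hermite[of e c] unfolding comaximal_def by blast
  have "e' * a1 * (x1 * x2) + e' * b1 * (y1 * x2) + c' * z
      = e' * x2 * (a1 * x1 + b1 * y1) + c' * z"
    by (simp add: algebra_simps)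
  then have "e' * a1 * (x1 * x2) + e' * b1 * (y1 * x2) + c' * z = 1" using ab ec by simp
  moreover have "a = d * (e' * a1)" "b = d * (e' * b1)" using ab ec by (simp_all add: mult.assoc)
  ultimately show thesis using that ec(2) by blast
qed

lemma hermite_row:
  fixes A :: "nat \<Rightarrow> nat \<Rightarrow> 'a"
  assumes "k \<noteq> l"
  obtains B where "array_equiv I {k, l} A B" "B i l = 0" "B i k dvd A i k" "B i k dvd A i l"
proof -
  obtain d a b x y where d: "A i k = d * a" "A i l = d * b" "a * x + b * y = 1"
    using hermite[of "A i k" "A i l"] unfolding comaximal_def by blast
  \<comment> \<open>Bezout coefficients and cofactors form a matrix of determinant 1 that sends
    \<open>(d * a, d * b)\<close> to \<open>(d, 0)\<close>.\<close>
  let ?B = "col_op k l x y (- b) a A"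
  have "x * a - y * (- b) = 1" using d(3) by (simp add: mult.commute)
  then have "array_equiv I {k, l} A ?B"
    using assms by (intro array_equiv.col array_equiv.refl) auto
  moreover have "?B i l = 0" using assms by (simp add: col_op_def d(1,2) algebra_simps)
  moreover have "?B i k = d * (a * x + b * y)" by (simp add: col_op_def d(1,2) algebra_simps)
  then have "?B i k = d" using d(3) by simp
  ultimately show thesis using that[of ?B] d by simp
qed

lemma has_pivot_1_1: "has_pivot {i} {k} (A :: nat \<Rightarrow> nat \<Rightarrow> 'a)"
  by (rule has_pivotI[OF array_equiv.refl]) auto

lemma has_pivot_1_2:
  assumes "k \<noteq> l"
  shows "has_pivot {i} {k, l} (A :: nat \<Rightarrow> nat \<Rightarrow> 'a)"
proof -
  obtain B where "array_equiv {i} {k, l} A B" "B i k dvd A i k" "B i k dvd A i l"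
    using hermite_row[OF assms, of "{i}" A i] by blast
  then show ?thesis by (intro has_pivotI[of _ _ _ B i k]) auto
qed

lemma has_pivot_2_2:
  fixes A :: "nat \<Rightarrow> nat \<Rightarrow> 'a"
  assumes "i \<noteq> j" "k \<noteq> l"
  shows "has_pivot {i, j} {k, l} A"
proof -
  obtain B where B: "array_equiv {i, j} {k, l} A B" "B i l = 0"
    using hermite_row[OF assms(2), of "{i, j}" A i] by blast
  obtain d a b c x y z where abc: "B i k = d * a" "B j k = d * b" "B j l = d * c"
    and "a * x + b * y + c * z = 1"
    using triangular_gcd[of "B i k" "B j k" "B j l"] by blast
  then obtain p q m n where 1: "p * (a * m) + q * (b * m + c * n) = 1" using kaplansky by blast
  \<comment> \<open>The row \<open>(p, q)\<close> and then the column \<open>(m, n)\<close> are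
    completed to determinant 1. Both determinants are the expression that \<open>kaplansky\<close>
    makes equal to \<open>1\<close>; \<open>p * a + q * b\<close> and \<open>q * c\<close> are row
    \<open>i\<close> of \<open>C\<close> without the factor \<open>d\<close>.\<close>
  define C where "C = row_op i j p q (- (b * m + c * n)) (a * m) B"
  define D where "D = col_op k l m n (- (q * c)) (p * a + q * b) C"
  have "p * (a * m) - q * - (b * m + c * n) = 1"
    using 1 by (simp only: mult_minus_right diff_minus_eq_add)
  then have "array_equiv {i, j} {k, l} B C"
    unfolding C_def using assms by (intro array_equiv.row array_equiv.refl) auto
  moreover have "m * (p * a + q * b) - n * - (q * c) = p * (a * m) + q * (b * m + c * n)"
    by (simp add: algebra_simps)
  ultimately have BD: "array_equiv {i, j} {k, l} B D"
    unfolding D_def using assms 1 by (intro array_equiv.col) simp_all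
  have "D i k = d * (p * (a * m) + q * (b * m + c * n))"
    using assms by (simp add: D_def C_def col_op_def row_op_def abc B(2) algebra_simps)
  then have Dd: "D i k = d" using 1 by simp
  have "d dvd B r s" if "r \<in> {i, j}" "s \<in> {k, l}" for r s
    using that B(2) abc by (auto simp: dvd_zero)
  then have "d dvd A r s" if "r \<in> {i, j}" "s \<in> {k, l}" for r s
    using array_equiv_dvd[OF array_equiv_sym[OF B(1)], of "{i, j}" "{k, l}" d] that by blast
  then show ?thesis
    using array_equiv_trans[OF B(1) BD] Dd by (intro has_pivotI[of _ _ _ D i k]) auto
qed

text \<open>Growing the rows at one or two columns and transposing gives one or two rows with all
  columns of \<open>K\<close>; these are the base cases for growing the rows to
  \<open>I\<close>.\<close>

lemma has_pivot:
  fixes A :: "nat \<Rightarrow> nat \<Rightarrow> 'a"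
  assumes "finite I" "I \<noteq> {}" "finite K" "K \<noteq> {}"
  shows "has_pivot I K A"
proof -
  have col1: "has_pivot I {k} A" if "finite I" "I \<noteq> {}" for I k and A :: "nat \<Rightarrow> nat \<Rightarrow> 'a"
    using that
  proof (rule has_pivot_induct)
    show "has_pivot {i} {k} A" for i and A :: "nat \<Rightarrow> nat \<Rightarrow> 'a" by (rule has_pivot_1_1)
    show "has_pivot {i, j} {k} A" if "i \<noteq> j" for i j and A :: "nat \<Rightarrow> nat \<Rightarrow> 'a"
      by (rule has_pivot_flip[OF has_pivot_1_2[OF that]])
  qed
  have 1: "has_pivot {i} K A" for i and A :: "nat \<Rightarrow> nat \<Rightarrow> 'a"
    by (rule has_pivot_flip[OF col1[OF assms(3,4)]])
  have col2: "has_pivot I {k, l} A" if "finite I" "I \<noteq> {}" "k \<noteq> l" for I k l and A :: "nat \<Rightarrow> nat \<Rightarrow> 'a"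
    using that(1,2)
  proof (rule has_pivot_induct)
    show "has_pivot {i} {k, l} A" for i and A :: "nat \<Rightarrow> nat \<Rightarrow> 'a"
      using that(3) by (rule has_pivot_1_2)
    show "has_pivot {i, j} {k, l} A" if "i \<noteq> j" for i j and A :: "nat \<Rightarrow> nat \<Rightarrow> 'a"
      using that \<open>k \<noteq> l\<close> by (rule has_pivot_2_2)
  qed
  have 2: "has_pivot {i, j} K A" if "i \<noteq> j" for i j and A :: "nat \<Rightarrow> nat \<Rightarrow> 'a"
    by (rule has_pivot_flip[OF col2[OF assms(3,4) that]])
  show ?thesis using assms(1,2) 1 2 by (rule has_pivot_induct)
qed

end

section \<open>Smith normal form\<close>

lemma array_equiv_move_row:
  assumes "i \<in> I" "t \<in> I"
  shows "\<exists>B. array_equiv I K A B \<and> B t = A i"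
proof (cases "i = t")
  case True
  then show ?thesis using array_equiv.refl by blast
next
  case False
  \<comment> \<open>A plain swap has determinant -1, so the displaced row is negated.\<close>
  let ?B = "row_op t i 0 1 (- 1) 0 A"
  have "array_equiv I K A ?B" using assms False by (intro array_equiv.row array_equiv.refl) auto
  moreover have "?B t = A i" by (simp add: row_op_def fun_eq_iff)
  ultimately show ?thesis by blast
qed

lemma array_equiv_move_column:
  assumes "k \<in> K" "t \<in> K"
  shows "\<exists>B. array_equiv I K A B \<and> (\<forall>r. B r t = A r k)"
proof -
  obtain B where B: "array_equiv K I (flip A) B" "B t = flip A k"
    using array_equiv_move_row[OF assms, of I "flip A"] by blast
  have "array_equiv I K A (flip B)" using array_equiv_flip[OF B(1)] .
  moreover have "\<forall>r. flip B r t = A r k" using B(2) by simp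
  ultimately show ?thesis by (intro exI[of _ "flip B"] conjI)
qed

lemma array_equiv_clear_column:
  assumes "finite S" "t \<notin> S" "S \<subseteq> I" "t \<in> I" "\<And>i. i \<in> S \<Longrightarrow> A t k dvd A i k"
  shows "\<exists>B. array_equiv I K A B \<and> (\<forall>i\<in>S. B i k = 0) \<and> (\<forall>i. i \<notin> S \<longrightarrow> B i = A i)"
  using assms
proof (induction S)
  case empty
  show ?case using array_equiv.refl by blast
next
  case (insert i S)
  then obtain B where B: "array_equiv I K A B" "\<forall>i\<in>S. B i k = 0" "\<forall>i. i \<notin> S \<longrightarrow> B i = A i"
    by auto
  obtain w where w: "A i k = A t k * w" using insert.prems(4)[of i] by (auto elim: dvdE)
  have it: "i \<noteq> t" using insert.prems(1) by auto
  let ?C = "row_op i t 1 (- w) 0 1 B"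
  have "array_equiv I K A ?C" using insert.prems it B(1) by (intro array_equiv.row) auto
  moreover have "B i k = A i k" "B t k = A t k" using B(3) insert by auto
  then have "?C i k = 0" by (simp add: row_op_def w mult.commute)
  then have "\<forall>r\<in>insert i S. ?C r k = 0" using B(2) insert.prems(1) by (auto simp: row_op_def)
  moreover have "\<forall>r. r \<notin> insert i S \<longrightarrow> ?C r = A r" using B(3) by (auto simp: row_op_def fun_eq_iff)
  ultimately show ?case by blast
qed

lemma array_equiv_clear_row:
  assumes "finite S" "t \<notin> S" "S \<subseteq> K" "t \<in> K" "\<And>k. k \<in> S \<Longrightarrow> A i t dvd A i k"
  shows "\<exists>B. array_equiv I K A B \<and> (\<forall>k\<in>S. B i k = 0) \<and> (\<forall>r k. k \<notin> S \<longrightarrow> B r k = A r k)"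
proof -
  obtain B where B: "array_equiv K I (flip A) B" "\<forall>k\<in>S. B k i = 0" "\<forall>k. k \<notin> S \<longrightarrow> B k = flip A k"
    using array_equiv_clear_column[of S t K "flip A" i I] assms by blast
  have "array_equiv I K A (flip B)" using array_equiv_flip[OF B(1)] .
  then show ?thesis using B(2,3) by (intro exI[of _ "flip B"]) simp
qed

lemma (in hermite_kaplansky) smith_normal_form:
  fixes A :: "nat \<Rightarrow> nat \<Rightarrow> 'a"
  shows "\<exists>B. array_equiv {t..<m} {t..<n} A B \<and>
    (\<forall>i\<in>{t..<m}. \<forall>k\<in>{t..<n}. i \<noteq> k \<longrightarrow> B i k = 0) \<and>
    (\<forall>i. t \<le> i \<and> i + 1 < m \<and> i + 1 < n \<longrightarrow> B i i dvd B (i + 1) (i + 1))"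
proof (induction "m - t" arbitrary: t A)
  case 0
  then show ?case by (intro exI[of _ A]) (auto intro: array_equiv.refl)
next
  case (Suc l)
  show ?case
  proof (cases "t < n")
    case False
    then show ?thesis by (intro exI[of _ A]) (auto intro: array_equiv.refl)
  next
    case True
    let ?I = "{t..<m}" and ?K = "{t..<n}" and ?I' = "{Suc t..<m}" and ?K' = "{Suc t..<n}"
    have t: "t \<in> ?I" "t \<in> ?K" using Suc(2) True by auto
    then have "has_pivot ?I ?K A" by (intro has_pivot) auto
    then obtain B i k where B: "array_equiv ?I ?K A B" "i \<in> ?I" "k \<in> ?K"
      "\<forall>r\<in>?I. \<forall>c\<in>?K. B i k dvd B r c"
      unfolding has_pivot_def by blast
    obtain B1 where B1: "array_equiv ?I ?K B B1" "B1 t = B i"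
      using array_equiv_move_row[OF B(2) t(1)] by blast
    obtain B2 where B2: "array_equiv ?I ?K B1 B2" "\<forall>r. B2 r t = B1 r k"
      using array_equiv_move_column[OF B(3) t(2)] by blast
    have BB2: "array_equiv ?I ?K B B2" using B1(1) B2(1) by (rule array_equiv_trans)
    have piv: "B2 t t = B i k" using B1(2) B2(2) by simp
    \<comment> \<open>The pivot value divides the block at every later stage: this allows the
      clearing and finally gives the first link of the divisibility chain.\<close>
    have all: "B i k dvd C r c" if "array_equiv ?I ?K B C" "r \<in> ?I" "c \<in> ?K" for C r c
      using array_equiv_dvd[OF that(1), of ?I ?K "B i k" r c] B(4) that(2,3) by blast
    have "B2 t t dvd B2 r t" if "r \<in> ?I'" for r
      using all[OF BB2, of r t] that t piv by auto
    then obtain C where C: "array_equiv ?I ?K B2 C" "\<forall>r\<in>?I'. C r t = 0" "\<forall>r. r \<notin> ?I' \<longrightarrow> C r = B2 r"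
      using array_equiv_clear_column[of ?I' t ?I B2 t ?K] t by auto
    have BC: "array_equiv ?I ?K B C" using BB2 C(1) by (rule array_equiv_trans)
    have "C t t dvd C t c" if "c \<in> ?K'" for c
      using all[OF BC, of t c] that t piv C(3) by auto
    then obtain D where D: "array_equiv ?I ?K C D" "\<forall>c\<in>?K'. D t c = 0"
      "\<forall>r c. c \<notin> ?K' \<longrightarrow> D r c = C r c"
      using array_equiv_clear_row[of ?K' t ?K C t ?I] t by auto
    \<comment> \<open>Clearing row \<open>t\<close> leaves column \<open>t\<close> unchanged, since
      \<open>t\<close> is not in \<open>?K'\<close>; its zeros survive.\<close>
    have Dt: "D t t = B i k" "\<forall>r\<in>?I'. D r t = 0" using D(3) C(2,3) piv by auto
    have l: "l = m - Suc t" using Suc(2) by simp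
    obtain E where E: "array_equiv ?I' ?K' D E"
      "\<forall>i\<in>?I'. \<forall>k\<in>?K'. i \<noteq> k \<longrightarrow> E i k = 0"
      "\<forall>i. Suc t \<le> i \<and> i + 1 < m \<and> i + 1 < n \<longrightarrow> E i i dvd E (i + 1) (i + 1)"
      using Suc(1)[OF l, of D] by blast
    have DE: "array_equiv ?I ?K D E" using E(1) by (rule array_equiv_mono) auto
    have BE: "array_equiv ?I ?K B E"
      using BC D(1) DE by (blast intro: array_equiv_trans)
    have Ett: "E t t = B i k" using array_equiv_outside[OF E(1), of t t] Dt(1) by simp
    \<comment> \<open>The recursive equivalence recombines zeros of row and column \<open>t\<close>
      only with each other: \<open>0\<close> remains a common divisor.\<close>
    have "E t c = 0" if "c \<in> ?K'" for c
      using array_equiv_dvd[OF E(1), of "{t}" ?K' 0 t c] D(2) that zero_dvd by (auto simp: dvd_zero)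
    moreover have "E r t = 0" if "r \<in> ?I'" for r
      using array_equiv_dvd[OF E(1), of ?I' "{t}" 0 r t] Dt(2) that zero_dvd by (auto simp: dvd_zero)
    ultimately have "\<forall>i\<in>?I. \<forall>k\<in>?K. i \<noteq> k \<longrightarrow> E i k = 0"
      using E(2) by (metis Suc_leI atLeastLessThan_iff le_neq_implies_less)
    moreover have "E i i dvd E (i + 1) (i + 1)" if "t \<le> i" "i + 1 < m" "i + 1 < n" for i
    proof (cases "i = t")
      case True
      then show ?thesis using all[OF BE, of "i + 1" "i + 1"] that Ett by simp
    next
      case False
      then show ?thesis using E(3) that by auto
    qed
    moreover have "array_equiv ?I ?K A E" using B(1) BE by (rule array_equiv_trans)
    ultimately show ?thesis by blast
  qed
qed

section \<open>Matrices\<close>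

abbreviation (input) delta :: "nat \<Rightarrow> nat \<Rightarrow> 'a::{comm_ring,comm_monoid_mult}" where
  "delta r c \<equiv> if r = c then 1 else 0"

lemma sum_delta_left: "s < m \<Longrightarrow> (\<Sum>t\<in>{0..<m}. x * delta s t * f t) = x * f s"
  for x :: "'a::{comm_ring,comm_monoid_mult}"
proof -
  assume "s < m"
  have "(\<Sum>t\<in>{0..<m}. x * delta s t * f t) = (\<Sum>t\<in>{0..<m}. if s = t then x * f t else 0)"
    by (intro sum.cong) auto
  then show ?thesis using \<open>s < m\<close> by simp
qed

lemma index_mat_mult:
  assumes "r < m" "c < n"
  shows "(mat m l (case_prod A) * mat l n (case_prod B)) $$ (r, c) = (\<Sum>t\<in>{0..<l}. A r t * B t c)"
  using assms by (auto simp: scalar_prod_def intro!: sum.cong)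

lemma one_mat_delta: "1\<^sub>m m = mat m m (case_prod delta)"
  by (intro eq_matI) auto

text \<open>The matrix of an operation is the operation applied to the identity array.\<close>

lemma row_op_mat:
  fixes A :: "nat \<Rightarrow> nat \<Rightarrow> 'a::{comm_ring,comm_monoid_mult}"
  assumes "i < m" "j < m"
  shows "mat m m (case_prod (row_op i j p q u v delta)) * mat m n (case_prod A)
    = mat m n (case_prod (row_op i j p q u v A))"
proof (rule eq_matI)
  fix r c assume "r < dim_row (mat m n (case_prod (row_op i j p q u v A)))"
    "c < dim_col (mat m n (case_prod (row_op i j p q u v A)))"
  then have rc: "r < m" "c < n" by auto
  have two: "(\<Sum>t\<in>{0..<m}. (x * delta i t + y * delta j t) * A t c) = x * A i c + y * A j c" for x y
    using sum_delta_left[OF assms(1), of x "\<lambda>t. A t c"] sum_delta_left[OF assms(2), of y "\<lambda>t. A t c"]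
    by (simp only: distrib_right sum.distrib)
  have "(\<Sum>t\<in>{0..<m}. delta r t * A t c) = A r c"
    using sum_delta_left[OF rc(1), of 1 "\<lambda>t. A t c"] by simp
  then have "(\<Sum>t\<in>{0..<m}. row_op i j p q u v delta r t * A t c) = row_op i j p q u v A r c"
    unfolding row_op_def using two by simp
  then show "(mat m m (case_prod (row_op i j p q u v delta)) * mat m n (case_prod A)) $$ (r, c)
    = mat m n (case_prod (row_op i j p q u v A)) $$ (r, c)"
    using rc by (simp only: index_mat_mult) simp
qed simp_all

lemma transpose_mat_case_prod: "(mat m n (case_prod A))\<^sup>T = mat n m (case_prod (flip A))"
  by (intro eq_matI) auto

lemma col_op_mat:
  fixes A :: "nat \<Rightarrow> nat \<Rightarrow> 'a::{comm_ring,comm_monoid_mult}"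
  assumes "i < n" "j < n"
  shows "mat m n (case_prod A) * mat n n (case_prod (col_op i j p q u v delta))
    = mat m n (case_prod (col_op i j p q u v A))"
proof -
  have d: "flip delta = (delta :: nat \<Rightarrow> nat \<Rightarrow> 'a)" by (auto simp: fun_eq_iff)
  have "(mat m n (case_prod A) * mat n n (case_prod (col_op i j p q u v delta)))\<^sup>T
      = mat n n (case_prod (row_op i j p q u v (flip delta))) * mat n m (case_prod (flip A))"
    by (subst transpose_mult[where nc = n])
      (auto simp: transpose_mat_case_prod flip_col_op)
  also have "\<dots> = mat n m (case_prod (row_op i j p q u v (flip A)))"
    unfolding d using assms by (rule row_op_mat)
  also have "\<dots> = (mat m n (case_prod (col_op i j p q u v A)))\<^sup>T"
    by (simp add: transpose_mat_case_prod flip_col_op)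
  finally show ?thesis by simp
qed

text \<open>The library proves the unit laws only for rings with \<open>0 \<noteq> 1\<close>.\<close>

lemma one_mat_mult_left: "A \<in> carrier_mat m n \<Longrightarrow> 1\<^sub>m m * A = A"
  for A :: "'a::{comm_ring,comm_monoid_mult} mat"
proof (rule eq_matI)
  fix r c assume A: "A \<in> carrier_mat m n" and rc: "r < dim_row A" "c < dim_col A"
  then show "(1\<^sub>m m * A) $$ (r, c) = A $$ (r, c)"
    using sum_delta_left[of r m 1 "\<lambda>t. A $$ (t, c)"] by (auto simp: scalar_prod_def)
qed auto

lemma one_mat_mult_right: "A \<in> carrier_mat m n \<Longrightarrow> A * 1\<^sub>m n = A"
  for A :: "'a::{comm_ring,comm_monoid_mult} mat"
proof (rule eq_matI)
  fix r c assume A: "A \<in> carrier_mat m n" and rc: "r < dim_row A" "c < dim_col A"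
  have "(\<Sum>t\<in>{0..<n}. A $$ (r, t) * delta t c) = (\<Sum>t\<in>{0..<n}. if t = c then A $$ (r, t) else 0)"
    by (intro sum.cong) auto
  then show "(A * 1\<^sub>m n) $$ (r, c) = A $$ (r, c)"
    using A rc by (auto simp: scalar_prod_def)
qed auto

lemma inv_mat_iff:
  fixes P :: "'a::{comm_ring,comm_monoid_mult} mat"
  assumes P: "P \<in> carrier_mat m m"
  shows "inv_mat P \<longleftrightarrow> (\<exists>B \<in> carrier_mat m m. P * B = 1\<^sub>m m \<and> B * P = 1\<^sub>m m)"
proof
  assume "inv_mat P"
  then obtain B where B: "P * B = 1\<^sub>m m" "B * P = 1\<^sub>m (dim_row B)" using P unfolding inv_mat_def by auto
  \<comment> \<open>\<open>inv_mat\<close> leaves the size of the inverse open; the column counts of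
    the two identities determine it.\<close>
  from arg_cong[OF B(1), of dim_col] arg_cong[OF B(2), of dim_col] P have "B \<in> carrier_mat m m"
    by auto
  then show "\<exists>B \<in> carrier_mat m m. P * B = 1\<^sub>m m \<and> B * P = 1\<^sub>m m" using B by auto
next
  assume "\<exists>B \<in> carrier_mat m m. P * B = 1\<^sub>m m \<and> B * P = 1\<^sub>m m"
  then show "inv_mat P" using P unfolding inv_mat_def by auto
qed

lemma inv_mat_one: "inv_mat (1\<^sub>m m :: 'a::{comm_ring,comm_monoid_mult} mat)"
  using one_mat_mult_left[of "1\<^sub>m m" m m] by (subst inv_mat_iff[of _ m]) auto

lemma inv_mat_mult:
  fixes P Q :: "'a::{comm_ring,comm_monoid_mult} mat"
  assumes P: "P \<in> carrier_mat m m" "inv_mat P" and Q: "Q \<in> carrier_mat m m" "inv_mat Q"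
  shows "inv_mat (P * Q)"
proof -
  obtain P' where P': "P' \<in> carrier_mat m m" "P * P' = 1\<^sub>m m" "P' * P = 1\<^sub>m m"
    using P inv_mat_iff by blast
  obtain Q' where Q': "Q' \<in> carrier_mat m m" "Q * Q' = 1\<^sub>m m" "Q' * Q = 1\<^sub>m m"
    using Q inv_mat_iff by blast
  note cs = P(1) Q(1) P'(1) Q'(1)
  have "(P * Q) * (Q' * P') = P * ((Q * Q') * P')"
    using cs by (simp add: assoc_mult_mat[of _ m m _ m _ m])
  moreover have "(Q' * P') * (P * Q) = Q' * ((P' * P) * Q)"
    using cs by (simp add: assoc_mult_mat[of _ m m _ m _ m])
  ultimately have "(P * Q) * (Q' * P') = 1\<^sub>m m \<and> (Q' * P') * (P * Q) = 1\<^sub>m m"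
    using P' Q' cs by (simp add: one_mat_mult_left[of _ m m])
  then show ?thesis
    unfolding inv_mat_iff[OF mult_carrier_mat[OF P(1) Q(1)]]
    by (rule bexI) (rule mult_carrier_mat[OF cs(4,3)])
qed

lemma inv_mat_row_op:
  assumes "i < m" "j < m" "i \<noteq> j" "p * v - q * u = (1::'a::{comm_ring,comm_monoid_mult})"
  shows "inv_mat (mat m m (case_prod (row_op i j p q u v delta)))"
proof -
  have det: "v * p - - q * - u = 1" using assms(4) by (simp add: mult.commute)
  show ?thesis
    by (subst inv_mat_iff[of _ m], simp,
        rule bexI[of _ "mat m m (case_prod (row_op i j v (- q) (- u) p delta))"])
      (use row_op_inverse[OF assms(3,4), of delta] row_op_inverse[OF assms(3) det, of delta]
        in \<open>simp_all add: row_op_mat assms(1,2) one_mat_delta\<close>)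
qed

lemma inv_mat_col_op:
  assumes "i < m" "j < m" "i \<noteq> j" "p * v - q * u = (1::'a::{comm_ring,comm_monoid_mult})"
  shows "inv_mat (mat m m (case_prod (col_op i j p q u v delta)))"
proof -
  have det: "v * p - - q * - u = 1" using assms(4) by (simp add: mult.commute)
  show ?thesis
    by (subst inv_mat_iff[of _ m], simp,
        rule bexI[of _ "mat m m (case_prod (col_op i j v (- q) (- u) p delta))"])
      (use col_op_inverse[OF assms(3,4), of delta] col_op_inverse[OF assms(3) det, of delta]
        in \<open>simp_all add: col_op_mat assms(1,2) one_mat_delta\<close>)
qed

lemma array_equiv_imp_inv_mat:
  assumes "array_equiv {0..<m} {0..<n} A B"
  shows "\<exists>P\<in>carrier_mat m m. \<exists>Q\<in>carrier_mat n n. inv_mat P \<and> inv_mat Q \<and>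
    P * mat m n (case_prod A) * Q = mat m n (case_prod B)"
  using assms
proof induction
  case refl
  show ?case
    by (intro bexI[of _ "1\<^sub>m m"] bexI[of _ "1\<^sub>m n"])
      (auto simp: inv_mat_one one_mat_mult_left[of _ m n] one_mat_mult_right[of _ m n])
next
  case (row B i j p v q u)
  let ?A = "mat m n (case_prod A)" and ?E = "mat m m (case_prod (row_op i j p q u v delta))"
  obtain P Q where PQ: "P \<in> carrier_mat m m" "Q \<in> carrier_mat n n" "inv_mat P" "inv_mat Q"
    "P * ?A * Q = mat m n (case_prod B)"
    using row.IH by blast
  have E: "?E \<in> carrier_mat m m" "inv_mat ?E" using row by (auto intro: inv_mat_row_op)
  have "?E * P * ?A * Q = ?E * (P * ?A * Q)"
    using E(1) PQ(1,2)
    by (simp add: assoc_mult_mat[of _ m m _ m _ n] assoc_mult_mat[of _ m m _ n _ n])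
  also have "\<dots> = mat m n (case_prod (row_op i j p q u v B))"
    using row row_op_mat[of i m j] by (simp add: PQ(5))
  finally show ?case using E PQ inv_mat_mult[OF E PQ(1,3)] by (intro bexI[of _ "?E * P"] bexI[of _ Q]) auto
next
  case (col B i j p v q u)
  let ?A = "mat m n (case_prod A)" and ?E = "mat n n (case_prod (col_op i j p q u v delta))"
  obtain P Q where PQ: "P \<in> carrier_mat m m" "Q \<in> carrier_mat n n" "inv_mat P" "inv_mat Q"
    "P * ?A * Q = mat m n (case_prod B)"
    using col.IH by blast
  have E: "?E \<in> carrier_mat n n" "inv_mat ?E" using col by (auto intro: inv_mat_col_op)
  have "P * ?A \<in> carrier_mat m n" using PQ(1) by auto
  then have "P * ?A * (Q * ?E) = P * ?A * Q * ?E"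
    using E(1) PQ(2) by (simp add: assoc_mult_mat[of _ m n _ n _ n])
  also have "\<dots> = mat m n (case_prod (col_op i j p q u v B))"
    using col col_op_mat[of i n j] by (simp add: PQ(5))
  finally show ?case using E PQ inv_mat_mult[OF PQ(2,4) E] by (intro bexI[of _ P] bexI[of _ "Q * ?E"]) auto
qed

lemma (in hermite_kaplansky) elementary_divisor_ring: "elementary_divisor_ring TYPE('a)"
  unfolding elementary_divisor_ring_def
proof
  fix M :: "'a mat"
  define m n where "m = dim_row M" and "n = dim_col M"
  let ?A = "\<lambda>i j. M $$ (i, j)"
  have M: "M = mat m n (case_prod ?A)" by (rule eq_matI) (simp_all add: m_def n_def)
  obtain B where B: "array_equiv {0..<m} {0..<n} ?A B"
    "\<forall>i\<in>{0..<m}. \<forall>k\<in>{0..<n}. i \<noteq> k \<longrightarrow> B i k = 0"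
    "\<forall>i. 0 \<le> i \<and> i + 1 < m \<and> i + 1 < n \<longrightarrow> B i i dvd B (i + 1) (i + 1)"
    using smith_normal_form[of 0 m n ?A] by (elim exE conjE)
  obtain P Q where PQ: "P \<in> carrier_mat m m" "Q \<in> carrier_mat n n" "inv_mat P" "inv_mat Q"
    "P * M * Q = mat m n (case_prod B)"
    using array_equiv_imp_inv_mat[OF B(1)] unfolding M[symmetric] by (elim bexE conjE)
  show "admits_diagonal_reduction M"
    unfolding admits_diagonal_reduction_def m_def[symmetric] n_def[symmetric]
    by (rule exI[of _ P], rule exI[of _ Q])
      (use PQ B(2,3) in \<open>auto simp: diagonal_mat_def\<close>)
qed

lemma mult_mat_in_ideal:
  fixes X Y :: "'a::{comm_ring,comm_monoid_mult} mat"
  assumes "is_ideal I" "X \<in> carrier_mat m l" "Y \<in> carrier_mat l n" "r < m" "c < n"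
    and "(\<forall>r<m. \<forall>c<l. X $$ (r, c) \<in> I) \<or> (\<forall>r<l. \<forall>c<n. Y $$ (r, c) \<in> I)"
  shows "(X * Y) $$ (r, c) \<in> I"
proof -
  have "X $$ (r, t) * Y $$ (t, c) \<in> I" if "t < l" for t
    using assms(6)
  proof
    assume "\<forall>r<m. \<forall>c<l. X $$ (r, c) \<in> I"
    then have "Y $$ (t, c) * X $$ (r, t) \<in> I" using assms that by (intro is_ideal_mult) auto
    then show ?thesis by (simp add: mult.commute)
  next
    assume "\<forall>r<l. \<forall>c<n. Y $$ (r, c) \<in> I"
    then show ?thesis using assms that by (intro is_ideal_mult) auto
  qed
  then have "(\<Sum>t\<in>{0..<l}. X $$ (r, t) * Y $$ (t, c)) \<in> I" by (intro is_ideal_sum assms(1)) auto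
  moreover have "(X * Y) $$ (r, c) = (\<Sum>t\<in>{0..<l}. X $$ (r, t) * Y $$ (t, c))"
    using assms(2-5) by (auto simp: scalar_prod_def intro!: sum.cong)
  ultimately show ?thesis by simp
qed

text \<open>Multiplication by invertible matrices preserves the ideal generated by the entries, and
  a reduced one-row matrix is \<open>(d, 0, ..., 0)\<close>.\<close>

lemma elementary_divisor_ring_imp_bezout_ring:
  assumes "elementary_divisor_ring TYPE('a::{comm_ring,comm_monoid_mult})"
  shows "bezout_ring TYPE('a)"
  unfolding bezout_ring_def
proof (intro allI impI)
  fix S :: "'a set" assume "finite S"
  then obtain xs where xs: "set xs = S" using finite_list by blast
  \<comment> \<open>the leading \<open>0\<close> makes the row nonempty\<close>
  define ys where "ys = 0 # xs"
  define n where "n = length ys"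
  define A where "A = mat 1 n (\<lambda>(i, j). ys ! j)"
  let ?J = "ideal_generated S"
  have A: "A \<in> carrier_mat 1 n" by (simp add: A_def)
  have dims: "dim_row A = 1" "dim_col A = n" by (simp_all add: A_def)
  have "admits_diagonal_reduction A" using assms by (simp add: elementary_divisor_ring_def)
  then obtain P Q where PQ: "P \<in> carrier_mat 1 1" "inv_mat P" "Q \<in> carrier_mat n n" "inv_mat Q"
    "diagonal_mat (P * A * Q)"
    unfolding admits_diagonal_reduction_def dims by (elim exE conjE)
  define B where "B = P * A * Q"
  define d where "d = B $$ (0, 0)"
  have PA: "P * A \<in> carrier_mat 1 n" using PQ(1) A by auto
  have B: "B \<in> carrier_mat 1 n" using PA PQ(3) by (auto simp: B_def)
  have n: "0 < n" by (simp add: n_def ys_def)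
  have J: "is_ideal ?J" by (rule is_ideal_ideal_generated)
  have "ys ! c \<in> ?J" if "c < n" for c
  proof -
    have "ys ! c \<in> insert 0 S" using that xs nth_mem[of c ys] by (auto simp: n_def ys_def)
    then show ?thesis using ideal_generated_superset[of S] is_ideal_zero[OF J] by auto
  qed
  then have AJ: "\<forall>r<1. \<forall>c<n. A $$ (r, c) \<in> ?J" by (simp add: A_def)
  have PAJ: "\<forall>r<1. \<forall>c<n. (P * A) $$ (r, c) \<in> ?J"
    using mult_mat_in_ideal[OF J PQ(1) A _ _ disjI2[OF AJ]] by simp
  have dJ: "d \<in> ?J"
    unfolding d_def B_def using n by (intro mult_mat_in_ideal[OF J PA PQ(3) _ _ disjI1[OF PAJ]]) simp_all
  have Bd: "B $$ (r, c) \<in> princ d" if "r < 1" "c < n" for r c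
  proof (cases "c = 0")
    case True
    then show ?thesis using that by (simp add: d_def princ_eq)
  next
    case False
    then have "B $$ (r, c) = 0" using PQ(5) that B unfolding B_def[symmetric] diagonal_mat_def by auto
    then show ?thesis by (simp add: princ_eq dvd_zero)
  qed
  obtain P' where P': "P' \<in> carrier_mat 1 1" "P' * P = 1\<^sub>m 1"
    using PQ(2) inv_mat_iff[OF PQ(1)] by blast
  have "\<forall>r<1. \<forall>c<n. B $$ (r, c) \<in> princ d" using Bd by blast
  then have PB: "(P' * B) $$ (r, c) \<in> princ d" if "r < 1" "c < n" for r c
    using mult_mat_in_ideal[OF is_ideal_princ P'(1) B that disjI2] by blast
  obtain Q' where Q': "Q' \<in> carrier_mat n n" "Q * Q' = 1\<^sub>m n"
    using PQ(4) inv_mat_iff[OF PQ(3)] by blast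
  have PB': "P' * B \<in> carrier_mat 1 n" using P'(1) B by auto
  have "P' * B = A * Q"
    unfolding B_def assoc_mult_mat[OF PQ(1) A PQ(3)]
    using assoc_mult_mat[OF P'(1) PQ(1) mult_carrier_mat[OF A PQ(3)]]
      one_mat_mult_left[OF mult_carrier_mat[OF A PQ(3)]] by (simp only: P'(2))
  then have "P' * B * Q' = A"
    using assoc_mult_mat[OF A PQ(3) Q'(1)] one_mat_mult_right[OF A] by (simp only: Q'(2))
  then have Ad: "A $$ (0, c) \<in> princ d" if "c < n" for c
    using mult_mat_in_ideal[OF is_ideal_princ PB' Q'(1) _ that, of 0 d] PB
    unfolding \<open>P' * B * Q' = A\<close> by simp
  have "S \<subseteq> princ d"
  proof
    fix x assume "x \<in> S"
    then have "x \<in> set ys" using xs by (simp add: ys_def)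
    then obtain c where "c < n" "ys ! c = x" unfolding n_def by (auto simp: in_set_conv_nth)
    then show "x \<in> princ d" using Ad[of c] by (simp add: A_def)
  qed
  then have "?J \<subseteq> princ d" by (rule ideal_generated_minimal) (rule is_ideal_princ)
  moreover have "princ d \<subseteq> ?J"
    using is_ideal_mult[OF J dJ] by (auto simp: princ_def mult.commute)
  ultimately show "\<exists>d. ?J = princ d" by blast
qed

theorem theorem3p8:
  assumes "feckly_adequate_range_1 TYPE('a::{comm_ring,comm_monoid_mult})"
  shows "elementary_divisor_ring TYPE('a) \<longleftrightarrow> bezout_ring TYPE('a)"
proof
  assume "bezout_ring TYPE('a)"
  then interpret hermite_kaplansky "TYPE('a)"
  proof unfold_locales
    assume bez: "bezout_ring TYPE('a)"
    show "\<exists>d a' b'. a = d * a' \<and> b = d * b' \<and> comaximal a' b'" for a b :: 'a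
      using feckly_adequate_range_1_hermite[OF bez assms, of a b] by metis
    show "\<exists>p q m n. p * (a * m) + q * (b * m + c * n) = 1" if "a * x + b * y + c * z = 1"
      for a b c x y z :: 'a
      using feckly_adequate_range_1_kaplansky[OF bez assms that] by metis
  qed
  show "elementary_divisor_ring TYPE('a)" by (rule elementary_divisor_ring)
qed (rule elementary_divisor_ring_imp_bezout_ring)

end
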